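(* Let $p$ be a prime and let $E\subset\mathbb{N}_0$ be $\sigma$-invariant, that is, $\sigma(E)\subset E$. Then $E=\overline{E}^p\cap\mathbb{N}_0$.
   Context: $\mathbb{N}_0=\{0,1,2,\dots\}$. $\overline{E}^p$ denotes the closure of $E\subset\mathbb{Z}\subset\mathbb{Z}_p$ in the ring $\mathbb{Z}_p$ of $p$-adic integers with metric $|x-y|_p$. The map $\sigma:\mathbb{N}_0\to\mathbb{N}_0$ deletes the leading base-$p$ digit: if $n=\sum_{i=0}^k a_ip^i$ with $a_i\in\{0,\dots,p-1\}$, $a_k\ne0$ and $k>0$, then $\sigma(n)=n-a_kp^k$; and $\sigma(a)=0$ for $a\in\{0,1,\dots,p-1\}$. *)

theory Defs
  imports "HOL-Analysis.Analysis" "HOL-Algebra.IntRing"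
begin

text \<open>
  The \<open>p\<close>-adic integers are the inverse limit of the rings of integers modulo \<open>p ^ n\<close>, each residue
  class being given by its representative in \<open>{0..<p ^ n}\<close>.
\<close>

definition padic_int_set :: "nat \<Rightarrow> (nat \<Rightarrow> int) set" where
  "padic_int_set p =
     {x. \<forall>n. 0 \<le> x n \<and> x n < int p ^ n \<and> x (Suc n) mod int p ^ n = x n}"

definition padic_int :: "nat \<Rightarrow> (nat \<Rightarrow> int) ring" where
  "padic_int p =
     \<lparr>carrier = padic_int_set p,
      mult = (\<lambda>x y n. (x n * y n) mod int p ^ n),
      one = (\<lambda>n. 1 mod int p ^ n),
      zero = (\<lambda>n. 0),
      add = (\<lambda>x y n. (x n + y n) mod int p ^ n)\<rparr>"

definition padic_of_int :: "nat \<Rightarrow> int \<Rightarrow> (nat \<Rightarrow> int)" where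
  "padic_of_int p a = (\<lambda>n. a mod int p ^ n)"

text \<open>
  For a \<open>p\<close>-adic integer \<open>x\<close>, the condition \<open>x n = 0\<close> means that \<open>p ^ n\<close> divides \<open>x\<close>, so the
  exponent below is the \<open>p\<close>-adic valuation of \<open>x\<close>.
\<close>

definition padic_abs :: "nat \<Rightarrow> (nat \<Rightarrow> int) \<Rightarrow> real" where
  "padic_abs p x =
     (if x = \<zero>\<^bsub>padic_int p\<^esub> then 0 else 1 / real p ^ (GREATEST n. x n = 0))"

text \<open>
  The value outside the carrier is immaterial; it is fixed because \<^locale>\<open>Metric_space\<close> requires
  symmetry and nonnegativity on the whole type.
\<close>

definition padic_dist :: "nat \<Rightarrow> (nat \<Rightarrow> int) \<Rightarrow> (nat \<Rightarrow> int) \<Rightarrow> real" where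
  "padic_dist p x y =
     (if x \<in> carrier (padic_int p) \<and> y \<in> carrier (padic_int p)
      then padic_abs p (x \<ominus>\<^bsub>padic_int p\<^esub> y) else 0)"

definition padic_closure :: "nat \<Rightarrow> int set \<Rightarrow> (nat \<Rightarrow> int) set" where
  "padic_closure p S =
     Abstract_Topology.closure_of
       (Metric_space.mtopology (carrier (padic_int p)) (padic_dist p)) (padic_of_int p ` S)"


definition digit :: "nat \<Rightarrow> nat \<Rightarrow> nat \<Rightarrow> nat" where
  "digit p n i = n div p ^ i mod p"

definition del_leading_digit :: "nat \<Rightarrow> nat \<Rightarrow> nat" where
  "del_leading_digit p n =
     (if n < p then 0
      else let k = (GREATEST i. digit p n i \<noteq> 0) in n - digit p n k * p ^ k)"


lemma padic_int_simps [simp]: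
  "carrier (padic_int p) = padic_int_set p"
  "x \<otimes>\<^bsub>padic_int p\<^esub> y = (\<lambda>n. (x n * y n) mod int p ^ n)"
  "\<one>\<^bsub>padic_int p\<^esub> = (\<lambda>n. 1 mod int p ^ n)"
  "\<zero>\<^bsub>padic_int p\<^esub> = (\<lambda>n. 0)"
  "x \<oplus>\<^bsub>padic_int p\<^esub> y = (\<lambda>n. (x n + y n) mod int p ^ n)"
  by (simp_all add: padic_int_def)

lemma padic_int_setD:
  assumes "x \<in> padic_int_set p"
  shows "0 \<le> x n" "x n < int p ^ n" "x (Suc n) mod int p ^ n = x n" "x n mod int p ^ n = x n"
  using assms by (auto simp: padic_int_set_def)

lemma padic_int_set_mod:
  assumes "x \<in> padic_int_set p" "m \<le> n"
  shows "x n mod int p ^ m = x m"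
  using assms(2)
proof (induction n rule: dec_induct)
  case base
  show ?case using padic_int_setD(4)[OF assms(1)] .
next
  case (step n)
  have "x (Suc n) mod int p ^ m = x (Suc n) mod int p ^ n mod int p ^ m"
    using step by (simp add: mod_mod_cancel le_imp_power_dvd)
  then show ?case using step padic_int_setD(3)[OF assms(1)] by simp
qed

lemma padic_int_setI:
  assumes "p > 0" "\<And>n. x n = f n mod int p ^ n" "\<And>n. f (Suc n) mod int p ^ n = f n mod int p ^ n"
  shows "x \<in> padic_int_set p"
proof -
  have "f (Suc n) mod int p ^ Suc n mod int p ^ n = f n mod int p ^ n" for n
    using assms(3)[of n] by (simp add: mod_mod_cancel)
  then show ?thesis using assms(1,2) by (simp add: padic_int_set_def)
qed

lemma padic_of_int_in_set: "p > 0 \<Longrightarrow> padic_of_int p a \<in> padic_int_set p"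
  by (rule padic_int_setI[where f = "\<lambda>_. a"]) (auto simp: padic_of_int_def)

lemma padic_add_closed:
  assumes "p > 0" "x \<in> padic_int_set p" "y \<in> padic_int_set p"
  shows "(\<lambda>n. (x n + y n) mod int p ^ n) \<in> padic_int_set p"
  by (rule padic_int_setI[where f = "\<lambda>n. x n + y n"])
     (use assms in \<open>auto simp: padic_int_setD intro!: mod_add_cong\<close>)

lemma padic_mult_closed:
  assumes "p > 0" "x \<in> padic_int_set p" "y \<in> padic_int_set p"
  shows "(\<lambda>n. (x n * y n) mod int p ^ n) \<in> padic_int_set p"
  by (rule padic_int_setI[where f = "\<lambda>n. x n * y n"])
     (use assms in \<open>auto simp: padic_int_setD intro!: mod_mult_cong\<close>)

lemma padic_uminus_closed:
  assumes "p > 0" "x \<in> padic_int_set p"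
  shows "(\<lambda>n. (- x n) mod int p ^ n) \<in> padic_int_set p"
  by (rule padic_int_setI[where f = "\<lambda>n. - x n"])
     (use assms in \<open>auto simp: padic_int_setD intro!: mod_minus_cong\<close>)

lemma padic_int_cring:
  assumes "p > 0"
  shows "cring (padic_int p)"
proof (rule cringI)
  have z: "(\<lambda>n. 0) \<in> padic_int_set p"
    using padic_of_int_in_set[OF assms, of 0] by (simp add: padic_of_int_def)
  have o: "(\<lambda>n. 1 mod int p ^ n) \<in> padic_int_set p"
    using padic_of_int_in_set[OF assms, of 1] by (simp add: padic_of_int_def)
  show "abelian_group (padic_int p)"
  proof (rule abelian_groupI)
    fix x assume "x \<in> carrier (padic_int p)"
    then show "\<exists>y\<in>carrier (padic_int p). y \<oplus>\<^bsub>padic_int p\<^esub> x = \<zero>\<^bsub>padic_int p\<^esub>"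
      using padic_uminus_closed[OF assms]
      by (intro bexI[of _ "\<lambda>n. (- x n) mod int p ^ n"]) (auto simp: mod_simps)
  next
    fix x y z
    show "x \<oplus>\<^bsub>padic_int p\<^esub> y \<oplus>\<^bsub>padic_int p\<^esub> z =
      x \<oplus>\<^bsub>padic_int p\<^esub> (y \<oplus>\<^bsub>padic_int p\<^esub> z)"
      by (simp add: mod_simps add.assoc)
    show "x \<oplus>\<^bsub>padic_int p\<^esub> y = y \<oplus>\<^bsub>padic_int p\<^esub> x"
      by (simp add: add.commute)
  qed (use assms z in \<open>simp_all add: padic_add_closed padic_int_setD(4)\<close>)
  show "Group.comm_monoid (padic_int p)"
  proof (rule comm_monoidI)
    fix x y z
    show "x \<otimes>\<^bsub>padic_int p\<^esub> y \<otimes>\<^bsub>padic_int p\<^esub> z =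
      x \<otimes>\<^bsub>padic_int p\<^esub> (y \<otimes>\<^bsub>padic_int p\<^esub> z)"
      by (simp add: mod_simps mult.assoc)
    show "x \<otimes>\<^bsub>padic_int p\<^esub> y = y \<otimes>\<^bsub>padic_int p\<^esub> x"
      by (simp add: mult.commute)
  qed (use assms o in \<open>simp_all add: padic_mult_closed padic_int_setD(4) mod_simps\<close>)
qed (auto simp: mod_simps distrib_right)

lemma padic_minus:
  assumes "p > 0" "x \<in> padic_int_set p" "y \<in> padic_int_set p"
  shows "x \<ominus>\<^bsub>padic_int p\<^esub> y = (\<lambda>n. (x n - y n) mod int p ^ n)"
proof -
  interpret cring "padic_int p" by (rule padic_int_cring) fact
  have "\<ominus>\<^bsub>padic_int p\<^esub> y = (\<lambda>n. (- y n) mod int p ^ n)"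
    by (rule minus_equality) (use assms padic_uminus_closed in \<open>auto simp: mod_simps\<close>)
  then show ?thesis by (simp add: a_minus_def mod_simps)
qed

lemma padic_of_int_ring_hom: "p > 0 \<Longrightarrow> padic_of_int p \<in> ring_hom \<Z> (padic_int p)"
  by (rule ring_hom_memI) (auto simp: padic_of_int_in_set, auto simp: padic_of_int_def mod_simps)

lemma inj_padic_of_int:
  assumes "p > 1"
  shows "inj (padic_of_int p)"
proof (rule injI)
  fix a b assume eq: "padic_of_int p a = padic_of_int p b"
  obtain n where n: "\<bar>a - b\<bar> < int p ^ n"
  proof
    have "nat \<bar>a - b\<bar> < p ^ nat \<bar>a - b\<bar>" using assms by (simp add: power_gt_expt)
    then have "int (nat \<bar>a - b\<bar>) < int (p ^ nat \<bar>a - b\<bar>)" by (simp only: of_nat_less_iff)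
    then show "\<bar>a - b\<bar> < int p ^ nat \<bar>a - b\<bar>" by simp
  qed
  have "int p ^ n dvd a - b"
    using fun_cong[OF eq, of n] by (simp add: padic_of_int_def mod_eq_dvd_iff)
  then show "a = b"
    using n zdvd_imp_le[of "int p ^ n" "\<bar>a - b\<bar>"] by (cases "a = b") auto
qed

lemma padic_abs_le_iff:
  assumes "p > 1" "x \<in> padic_int_set p"
  shows "padic_abs p x \<le> 1 / real p ^ n \<longleftrightarrow> x n = 0"
proof (cases "x = (\<lambda>n. 0)")
  case True
  then show ?thesis by (simp add: padic_abs_def)
next
  case False
  then obtain m where m: "x m \<noteq> 0" by auto
  have mono: "x i = 0" if "x j = 0" "i \<le> j" for i j
    using padic_int_set_mod[OF assms(2) that(2)] that(1) by simp
  define v where "v = (GREATEST n. x n = 0)"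
  have bd: "\<And>j. x j = 0 \<Longrightarrow> j \<le> m" using m mono by (meson nat_le_linear)
  have "x 0 = 0" using padic_int_setD(1,2)[OF assms(2), of 0] by simp
  then have v: "x v = 0" unfolding v_def using bd by (rule GreatestI_nat)
  have "x j = 0 \<Longrightarrow> j \<le> v" for j unfolding v_def by (rule Greatest_le_nat) (use bd in auto)
  then have "x n = 0 \<longleftrightarrow> n \<le> v" using v mono by blast
  moreover have "1 / real p ^ v \<le> 1 / real p ^ n \<longleftrightarrow> n \<le> v"
    using assms(1) by (simp add: field_simps power_increasing_iff)
  ultimately show ?thesis using False by (simp add: padic_abs_def v_def)
qed

lemma padic_abs_of_int:
  assumes "p > 1" "a \<noteq> 0"
  shows "padic_abs p (padic_of_int p a) = 1 / real p ^ multiplicity (int p) a"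
proof -
  have "padic_of_int p a \<noteq> padic_of_int p 0"
    using inj_padic_of_int[OF assms(1)] assms(2) by (auto dest: injD)
  moreover have "(GREATEST n. padic_of_int p a n = 0) = multiplicity (int p) a"
    by (rule Greatest_equality)
       (use assms in \<open>auto simp: padic_of_int_def mod_eq_0_iff_dvd multiplicity_dvd
          intro!: multiplicity_geI\<close>)
  ultimately show ?thesis by (auto simp: padic_abs_def padic_of_int_def)
qed

lemma padic_dist_le_iff:
  assumes "p > 1" "x \<in> padic_int_set p" "y \<in> padic_int_set p"
  shows "padic_dist p x y \<le> 1 / real p ^ n \<longleftrightarrow> x n = y n"
proof -
  interpret cring "padic_int p" by (rule padic_int_cring) (use assms in simp)
  have "x \<ominus>\<^bsub>padic_int p\<^esub> y \<in> padic_int_set p"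
    using minus_closed assms by simp
  then have "padic_dist p x y \<le> 1 / real p ^ n \<longleftrightarrow> (x n - y n) mod int p ^ n = 0"
    using assms padic_abs_le_iff[of p "x \<ominus>\<^bsub>padic_int p\<^esub> y" n]
    by (simp add: padic_dist_def padic_minus)
  also have "\<dots> \<longleftrightarrow> x n mod int p ^ n = y n mod int p ^ n"
    by (simp add: mod_eq_dvd_iff mod_eq_0_iff_dvd)
  finally show ?thesis using assms by (simp add: padic_int_setD)
qed

lemma padic_dist_cases: "padic_dist p x y = 0 \<or> (\<exists>n. padic_dist p x y = 1 / real p ^ n)"
  by (auto simp: padic_dist_def padic_abs_def)

lemma padic_dist_nonneg: "padic_dist p x y \<ge> 0"
  by (auto simp: padic_dist_def padic_abs_def)

lemma padic_dist_eq_0_iff: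
  assumes "p > 1" "x \<in> padic_int_set p" "y \<in> padic_int_set p"
  shows "padic_dist p x y = 0 \<longleftrightarrow> x = y"
proof
  assume "padic_dist p x y = 0"
  then have "padic_dist p x y \<le> 1 / real p ^ n" for n by simp
  then have "x n = y n" for n using padic_dist_le_iff[OF assms] by blast
  then show "x = y" by (rule ext)
next
  assume "x = y"
  have "y \<ominus>\<^bsub>padic_int p\<^esub> y = \<zero>\<^bsub>padic_int p\<^esub>"
    using padic_minus[of p y y] assms(1,3) by simp
  then show "padic_dist p x y = 0"
    unfolding \<open>x = y\<close> padic_dist_def padic_abs_def by simp
qed

lemma padic_dist_ultrametric:
  assumes "p > 1" "x \<in> padic_int_set p" "y \<in> padic_int_set p" "z \<in> padic_int_set p"
  shows "padic_dist p x z \<le> max (padic_dist p x y) (padic_dist p y z)"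
proof -
  have "max (padic_dist p x y) (padic_dist p y z) \<in> {padic_dist p x y, padic_dist p y z}"
    by (simp add: max_def)
  then consider "max (padic_dist p x y) (padic_dist p y z) = 0"
    | n where "max (padic_dist p x y) (padic_dist p y z) = 1 / real p ^ n"
    using padic_dist_cases[of p x y] padic_dist_cases[of p y z] by (elim insertE emptyE) metis+
  then show ?thesis
  proof cases
    case 1
    then have "padic_dist p x y = 0" "padic_dist p y z = 0"
      using padic_dist_nonneg[of p x y] padic_dist_nonneg[of p y z] by linarith+
    then show ?thesis using assms by (simp add: padic_dist_eq_0_iff)
  next
    case 2
    then have "padic_dist p x y \<le> 1 / real p ^ n" "padic_dist p y z \<le> 1 / real p ^ n" by linarith+
    then have "x n = z n" using assms padic_dist_le_iff by metis
    then show ?thesis unfolding 2 using assms padic_dist_le_iff by metis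
  qed
qed

lemma padic_Metric_space:
  assumes "p > 1"
  shows "Metric_space (carrier (padic_int p)) (padic_dist p)"
proof
  fix x y
  show "0 \<le> padic_dist p x y" by (rule padic_dist_nonneg)
  show "padic_dist p x y = padic_dist p y x"
  proof (cases "x \<in> padic_int_set p \<and> y \<in> padic_int_set p")
    case True
    have "padic_dist p x y \<le> max (padic_dist p y x) 0"
      if "x \<in> padic_int_set p" "y \<in> padic_int_set p" for x y
      using padic_dist_cases[of p y x]
    proof
      assume "padic_dist p y x = 0"
      then show ?thesis using assms that padic_dist_eq_0_iff by fastforce
    next
      assume "\<exists>n. padic_dist p y x = 1 / real p ^ n"
      then obtain n where n: "padic_dist p y x = 1 / real p ^ n" by blast
      then have "padic_dist p x y \<le> 1 / real p ^ n"
        using assms that padic_dist_le_iff[of p x y n] padic_dist_le_iff[of p y x n] by simp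
      then show ?thesis unfolding n by simp
    qed
    then show ?thesis using True padic_dist_nonneg
      by (metis max.absorb1 order_antisym)
  qed (auto simp: padic_dist_def)
next
  fix x y assume "x \<in> carrier (padic_int p)" "y \<in> carrier (padic_int p)"
  then show "padic_dist p x y = 0 \<longleftrightarrow> x = y" using assms by (simp add: padic_dist_eq_0_iff)
next
  fix x y z
  assume "x \<in> carrier (padic_int p)" "y \<in> carrier (padic_int p)" "z \<in> carrier (padic_int p)"
  then have "padic_dist p x z \<le> max (padic_dist p x y) (padic_dist p y z)"
    using assms by (simp add: padic_dist_ultrametric)
  then show "padic_dist p x z \<le> padic_dist p x y + padic_dist p y z"
    using padic_dist_nonneg[of p x y] padic_dist_nonneg[of p y z] by linarith
qed

lemma sum_digits_less:
  assumes "p > (0::nat)" "\<And>i. i < k \<Longrightarrow> a i < p"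
  shows "(\<Sum>i<k. a i * p ^ i) < p ^ k"
  using assms(2)
proof (induction k)
  case (Suc k)
  have "a k \<le> p - 1" using Suc.prems[of k] by simp
  then have "a k * p ^ k \<le> (p - 1) * p ^ k" by (rule mult_le_mono1)
  moreover have "(\<Sum>i<k. a i * p ^ i) < p ^ k" using Suc by simp
  ultimately have "(\<Sum>i<Suc k. a i * p ^ i) < p ^ k + (p - 1) * p ^ k"
    unfolding sum.lessThan_Suc by (rule add_less_le_mono[rotated])
  also have "\<dots> = p ^ Suc k" using assms(1) by (cases p) auto
  finally show ?case .
qed simp

lemma del_leading_digit_expansion:
  assumes "k > 0" "\<And>i. i \<le> k \<Longrightarrow> a i < p" "a k \<noteq> 0"
  shows "del_leading_digit p (\<Sum>i\<le>k. a i * p ^ i) = (\<Sum>i\<le>k. a i * p ^ i) - a k * p ^ k"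
proof -
  define n where "n = (\<Sum>i\<le>k. a i * p ^ i)"
  have p: "p > 1" using assms(2)[of k] assms(3) by linarith
  have r: "(\<Sum>i<k. a i * p ^ i) < p ^ k" by (rule sum_digits_less) (use assms p in auto)
  have n: "n = (\<Sum>i<k. a i * p ^ i) + a k * p ^ k"
    unfolding n_def by (simp add: lessThan_Suc_atMost[symmetric])
  have dk: "n div p ^ k = a k" unfolding n using r p by simp
  then have digk: "digit p n k = a k" using assms(2)[of k] by (simp add: digit_def)
  have above: "digit p n i = 0" if "i > k" for i
  proof -
    have "p ^ i = p ^ k * p ^ (i - k)" using that by (simp flip: power_add)
    then have "n div p ^ i = a k div p ^ (i - k)" by (simp add: div_mult2_eq dk)
    moreover have "a k < p ^ (i - k)"
    proof -
      have "a k < p" by (rule assms(2)) simp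
      also have "p \<le> p ^ (i - k)" using p that by (simp add: self_le_power)
      finally show ?thesis .
    qed
    ultimately show ?thesis by (simp add: digit_def)
  qed
  have "i \<le> k" if "digit p n i \<noteq> 0" for i
    by (rule ccontr) (use above[of i] that in simp)
  then have g: "(GREATEST i. digit p n i \<noteq> 0) = k"
    by (intro Greatest_equality) (simp_all add: digk assms(3))
  have "p \<le> p ^ k" using assms(1) p by (simp add: self_le_power)
  also have "\<dots> \<le> a k * p ^ k" using assms(3) by simp
  also have "\<dots> \<le> n" unfolding n by simp
  finally have "\<not> n < p" by simp
  then show ?thesis unfolding n_def[symmetric] del_leading_digit_def g Let_def digk by simp
qed

lemma del_leading_digit_less: "a < p \<Longrightarrow> del_leading_digit p a = 0"
  by (simp add: del_leading_digit_def)

end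

theory Submission
  imports Defs
begin

text \<open>
  Let \<open>n < p ^ k\<close> with \<open>k > 0\<close>. If \<open>n\<close> lies in the closure of \<open>E\<close>, then some \<open>m \<in> E\<close> satisfies
  \<open>m mod p ^ k = n\<close>. As long as \<open>m \<ge> p ^ k\<close>, deleting the leading digit of \<open>m\<close> makes \<open>m\<close> smaller
  without changing it modulo \<open>p ^ k\<close>, so the iteration stays in \<open>E\<close> and ends at \<open>n\<close>.
\<close>

text \<open>If p^i \<le> m < p^(i+1), then digit i of m is nonzero and i \<ge> k, so the greatest
  nonzero position j is also at least k. The bound \<open>c * p ^ j \<le> m\<close> ensures that the
  subtraction on naturals is not truncated.\<close>

lemma del_leading_digit_obtain:
  assumes "p > 1" "k > 0" "p ^ k \<le> m"
  obtains c j where "c > 0" "k \<le> j" "c * p ^ j \<le> m" "del_leading_digit p m = m - c * p ^ j"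
proof -
  have "1 \<le> m" using assms(1,3) by (meson le_trans one_le_power less_imp_le)
  then obtain i where i: "p ^ i \<le> m" "m < p ^ (i + 1)"
    using ex_power_ivl1[of p m] assms(1) by auto
  have "p ^ k < p ^ (i + 1)" using assms(3) i(2) by linarith
  then have "k < i + 1" by (rule power_less_imp_less_exp[OF assms(1)])
  then have "k \<le> i" by simp
  have "m div p ^ i < p" using i(2) by (simp add: less_mult_imp_div_less)
  moreover have "m div p ^ i > 0" using i(1) assms(1) by (simp add: div_greater_zero_iff)
  ultimately have di: "digit p m i \<noteq> 0" by (simp add: digit_def)
  \<comment> \<open>\<open>GREATEST\<close> needs a bound on the nonzero positions; m itself serves,
    since m < p^l whenever l > m.\<close>
  have bd: "l \<le> m" if "digit p m l \<noteq> 0" for l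
  proof (rule ccontr)
    assume "\<not> l \<le> m"
    then have "m < p ^ l" using power_gt_expt[of p l] assms(1) by linarith
    then show False using that by (simp add: digit_def)
  qed
  define j where "j = (GREATEST l. digit p m l \<noteq> 0)"
  have dj: "digit p m j \<noteq> 0"
    unfolding j_def using di bd by (rule GreatestI_nat)
  have "i \<le> j"
    unfolding j_def using di bd by (rule Greatest_le_nat)
  \<comment> \<open>Here k > 0 excludes the branch for single digits in
    \<open>del_leading_digit\<close>.\<close>
  have "p \<le> p ^ k" using assms(1,2) by (simp add: self_le_power)
  then have "\<not> m < p" using assms(3) by linarith
  then have del: "del_leading_digit p m = m - digit p m j * p ^ j"
    by (simp add: del_leading_digit_def j_def Let_def)
  have "digit p m j * p ^ j \<le> m div p ^ j * p ^ j"
    by (simp add: digit_def)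
  also have "\<dots> \<le> m" by simp
  finally show ?thesis
    using that[of "digit p m j" j] dj del \<open>k \<le> i\<close> \<open>i \<le> j\<close> by simp
qed

lemma mod_power_in_invariant_set:
  assumes "p > 1" "k > 0" "del_leading_digit p ` E \<subseteq> E" "m \<in> E"
  shows "m mod p ^ k \<in> E"
  using assms(4)
proof (induction m rule: less_induct)
  case (less m)
  show ?case
  proof (cases "m < p ^ k")
    case True
    then show ?thesis using less.prems by simp
  next
    case False
    then have "p ^ k \<le> m" by simp
    from del_leading_digit_obtain[OF assms(1,2) this] obtain c j where cj:
      "c > 0" "k \<le> j" "c * p ^ j \<le> m" "del_leading_digit p m = m - c * p ^ j"
      by blast
    define m' where "m' = m - c * p ^ j"
    have m: "m = m' + c * p ^ j" using cj(3) by (simp add: m'_def)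
    have "m' \<in> E" using assms(3) less.prems cj(4) by (auto simp: m'_def)
    moreover have "m' < m" using m cj(1) assms(1) by simp
    ultimately have "m' mod p ^ k \<in> E" using less.IH by blast
    \<comment> \<open>As k \<le> j, the deleted term is invisible modulo p^k.\<close>
    moreover have "p ^ k dvd c * p ^ j" using cj(2) by (simp add: le_imp_power_dvd)
    then have "m mod p ^ k = m' mod p ^ k" unfolding m by (auto elim!: dvdE)
    ultimately show ?thesis by simp
  qed
qed

text \<open>The closed ball of radius p^(-n) is a residue class modulo p^n, and these radii tend to
  0, so approximation by S amounts to congruences modulo every p^n.\<close>

lemma padic_of_int_in_closure_iff:
  assumes "p > 1"
  shows "padic_of_int p a \<in> padic_closure p S \<longleftrightarrow>
    (\<forall>n. \<exists>b\<in>S. b mod int p ^ n = a mod int p ^ n)"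
proof -
  interpret Metric_space "padic_int_set p" "padic_dist p"
    using padic_Metric_space[OF assms] by simp
  have set: "padic_of_int p b \<in> padic_int_set p" for b
    using assms by (simp add: padic_of_int_in_set)
  have le: "padic_dist p (padic_of_int p a) (padic_of_int p b) \<le> 1 / real p ^ n \<longleftrightarrow>
      b mod int p ^ n = a mod int p ^ n" for b n
    using padic_dist_le_iff[OF assms set set] by (auto simp: padic_of_int_def)
  have "padic_of_int p a \<in> padic_closure p S \<longleftrightarrow>
      (\<forall>r>0. \<exists>b\<in>S. padic_dist p (padic_of_int p a) (padic_of_int p b) < r)"
    unfolding padic_closure_def padic_int_simps metric_closure_of using set by auto
  also have "\<dots> \<longleftrightarrow> (\<forall>n. \<exists>b\<in>S. b mod int p ^ n = a mod int p ^ n)"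
  proof (intro iffI allI impI)
    fix n
    assume "\<forall>r>0. \<exists>b\<in>S. padic_dist p (padic_of_int p a) (padic_of_int p b) < r"
    moreover have "1 / real p ^ n > 0" using assms by simp
    ultimately obtain b where
      "b \<in> S" "padic_dist p (padic_of_int p a) (padic_of_int p b) < 1 / real p ^ n"
      by blast
    then show "\<exists>b\<in>S. b mod int p ^ n = a mod int p ^ n"
      using le[of b n] by auto
  next
    fix r :: real
    assume *: "\<forall>n. \<exists>b\<in>S. b mod int p ^ n = a mod int p ^ n" and "r > 0"
    then obtain n where "(1 / real p) ^ n < r"
      using real_arch_pow_inv[of r "1 / real p"] assms by auto
    then have n: "1 / real p ^ n < r" by (simp add: power_one_over)
    from * obtain b where "b \<in> S" "b mod int p ^ n = a mod int p ^ n" by blast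
    then show "\<exists>b\<in>S. padic_dist p (padic_of_int p a) (padic_of_int p b) < r"
      using le[of b n] n by force
  qed
  finally show ?thesis .
qed

theorem lemma3p3:
  fixes p :: nat and E :: "nat set"
  assumes "prime p"
    and "del_leading_digit p ` E \<subseteq> E"
  shows "E = {n. padic_of_int p (int n) \<in> padic_closure p (int ` E)}"
proof -
  have p: "p > 1" using assms(1) by (rule prime_gt_1_nat)
  have "n \<in> E" if "padic_of_int p (int n) \<in> padic_closure p (int ` E)" for n
  proof -
    \<comment> \<open>The exponent \<open>Suc n\<close> is positive even for n = 0, and large enough
      for n to be its own residue.\<close>
    have less: "n < p ^ Suc n"
      using power_gt_expt[of p "Suc n"] p by linarith
    from that obtain m where "m \<in> E" "int m mod int p ^ Suc n = int n mod int p ^ Suc n"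
      unfolding padic_of_int_in_closure_iff[OF p] by blast
    then have "int (m mod p ^ Suc n) = int (n mod p ^ Suc n)"
      by (simp only: of_nat_mod of_nat_power)
    then have "m mod p ^ Suc n = n" using less by (simp only: of_nat_eq_iff mod_less)
    then show ?thesis
      using mod_power_in_invariant_set[OF p _ assms(2) \<open>m \<in> E\<close>, of "Suc n"] by simp
  qed
  \<comment> \<open>For the other inclusion, n itself is the witness for every modulus.\<close>
  then show ?thesis by (auto simp: padic_of_int_in_closure_iff[OF p])
qed

end
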